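(* Let $\mathcal{V}$ be a closed monoidal category (not assumed symmetric). Let $\mathcal{S}$ be a category with $\mathcal{V}$-structure, and consider also the $\mathcal{V}$-category associated with it. (1) If $\mathcal{S}$ has cylinder, with $K$-cylinders $(K\otimes X,\alpha_{K,X},\{\underline\phi_{K,X,Y}\}_{Y\in\operatorname{ob}\mathcal{S}})$, then the $\mathcal{V}$-category associated with $\mathcal{S}$ is tensored, with the tensor of $K$ and $X$ being the object $K\otimes X$ of the cylinder and the required isomorphisms being the $\underline\phi_{K,X,Y}:\underline{\mathcal{S}}(K\otimes X,Y)\to\underline{\mathcal{V}}(K,\underline{\mathcal{S}}(X,Y))$ of the cylinder; in particular these are $\mathcal{V}$-natural in $Y$. (2) If the $\mathcal{V}$-category associated with $\mathcal{S}$ is tensored, with tensors $K\otimes X$ and isomorphisms $\underline\phi_{K,X,Y}:\underline{\mathcal{S}}(K\otimes X,Y)\to\underline{\mathcal{V}}(K,\underline{\mathcal{S}}(X,Y))$ $\mathcal{V}$-natural in $Y$, then $\mathcal{S}$ has cylinder: for every $K\in\operatorname{ob}\mathcal{V}$ and $X\in\operatorname{ob}\mathcal{S}$, $$\bigl(K\otimes X,\ \varpi^{-1}(\underline\phi_{K,X,K\otimes X}\cdot j_{K\otimes X}),\ \{\underline\phi_{K,X,Y}\}_{Y\in\operatorname{ob}\mathcal{S}}\bigr)$$ is a $K$-cylinder of $X$.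
   Context: Composition of morphisms is written $g\cdot f$. A monoidal category $\mathcal{V}=(\mathcal{V},\otimes,I,a,l,r)$ has structure isomorphisms $a_{X,Y,Z}:(X\otimes Y)\otimes Z\to X\otimes(Y\otimes Z)$, $l_X:I\otimes X\to X$, $r_X:X\otimes I\to X$. It is closed if for every $Y$ the functor $-\otimes Y$ has a right adjoint $\underline{\mathcal{V}}(Y,-)$; the adjunction bijection is $\pi_{X,Y,Z}:\mathcal{V}(X\otimes Y,Z)\to\mathcal{V}(X,\underline{\mathcal{V}}(Y,Z))$, with counit $\epsilon_Z:\underline{\mathcal{V}}(Y,Z)\otimes Y\to Z$. The bijection $\varpi_{X,Y}:\mathcal{V}(X,Y)\to\mathcal{V}(I,\underline{\mathcal{V}}(X,Y))$ is $\varpi(f)=\pi_{I,X,Y}(f\cdot l_X)$. A category $\mathcal{S}$ has a $\mathcal{V}$-structure if it is equipped with: a functor $\underline{\mathcal{S}}(-,-):\mathcal{S}^{\mathrm{op}}\times\mathcal{S}\to\mathcal{V}$; for all $X,Y,Z$ a morphism $\underline{\bullet}_{X,Y,Z}:\underline{\mathcal{S}}(Y,Z)\otimes\underline{\mathcal{S}}(X,Y)\to\underline{\mathcal{S}}(X,Z)$ of $\mathcal{V}$; and a natural isomorphism $\varphi:\mathcal{S}(-,-)\to\mathcal{V}(I,\underline{\mathcal{S}}(-,-))$; such that (i) $\underline{\bullet}\cdot(\underline{\bullet}\otimes1)=\underline{\bullet}\cdot(1\otimes\underline{\bullet})\cdot a$ as morphisms $(\underline{\mathcal{S}}(Z,W)\otimes\underline{\mathcal{S}}(Y,Z))\otimes\underline{\mathcal{S}}(X,Y)\to\underline{\mathcal{S}}(X,W)$;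 (ii) for $f\in\mathcal{S}(X,Y)$, $\underline{\mathcal{S}}(f,Z)=\underline{\bullet}\cdot(1\otimes\varphi(f))\cdot r^{-1}$; (iii) for $g\in\mathcal{S}(Y,Z)$, $\underline{\mathcal{S}}(X,g)=\underline{\bullet}\cdot(\varphi(g)\otimes1)\cdot l^{-1}$. The $\mathcal{V}$-category associated with $\mathcal{S}$ (also denoted $\mathcal{S}$) has the same objects, hom-objects $\underline{\mathcal{S}}(A,B)$, composition morphisms $\underline{\bullet}$, and unit morphisms $j_A=\varphi(1_A):I\to\underline{\mathcal{S}}(A,A)$. The closed monoidal category $\mathcal{V}$ is itself a $\mathcal{V}$-category with hom-objects $\underline{\mathcal{V}}(X,Y)$, composition $\underline{\bullet}_{X,Y,Z}=\pi(\epsilon_Z\cdot(1\otimes\epsilon_Y)\cdot a)$, and units $j_X=\varpi(1_X)$. Cylinder: for $K\in\operatorname{ob}\mathcal{V}$, $X\in\operatorname{ob}\mathcal{S}$, a $K$-cylinder of $X$ is a triple $(K\otimes X,\alpha_{K,X},\{\underline\phi_{K,X,Y}\}_{Y\in\operatorname{ob}\mathcal{S}})$ where $K\otimes X\in\operatorname{ob}\mathcal{S}$, $\alpha_{K,X}:K\to\underline{\mathcal{S}}(X,K\otimes X)$ is a morphism of $\mathcal{V}$, and $\underline\phi_{K,X,Y}:\underline{\mathcal{S}}(K\otimes X,Y)\to\underline{\mathcal{V}}(K,\underline{\mathcal{S}}(X,Y))$ is an isomorphism of $\mathcal{V}$ for each $Y$, such that $\epsilon_{\underline{\mathcal{S}}(X,Y)}\cdot(\underline\phi_{K,X,Y}\otimes1)=\underline{\bullet}\cdot(1\otimes\alpha_{K,X})$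 as morphisms $\underline{\mathcal{S}}(K\otimes X,Y)\otimes K\to\underline{\mathcal{S}}(X,Y)$. $\mathcal{S}$ has cylinder if it is equipped with a $K$-cylinder of $X$ for all $K,X$. Tensored: a $\mathcal{V}$-category $\mathcal{S}$ is tensored if for all $K\in\operatorname{ob}\mathcal{V}$, $X\in\operatorname{ob}\mathcal{S}$ there is an object $K\otimes X$ of $\mathcal{S}$ (the tensor of $K$ and $X$) and for all $K,X,Y$ an isomorphism $\underline\phi_{K,X,Y}:\underline{\mathcal{S}}(K\otimes X,Y)\to\underline{\mathcal{V}}(K,\underline{\mathcal{S}}(X,Y))$ of $\mathcal{V}$ which is $\mathcal{V}$-natural in $Y$. $\mathcal{V}$-naturality: for $\mathcal{V}$-functors $S,T:\mathcal{A}\to\mathcal{B}$, a $\mathcal{V}$-natural transformation is a family $\alpha_A:I\to\underline{\mathcal{B}}(SA,TA)$ such that $\underline{\bullet}\cdot(\alpha_B\otimes S_{A,B})\cdot l^{-1}=\underline{\bullet}\cdot(T_{A,B}\otimes\alpha_A)\cdot r^{-1}:\underline{\mathcal{A}}(A,B)\to\underline{\mathcal{B}}(SA,TB)$ for all $A,B$. For a $\mathcal{V}$-category $\mathcal{A}$ and $A\in\operatorname{ob}\mathcal{A}$, the $\mathcal{V}$-functor $\underline{\mathcal{A}}(A,-):\mathcal{A}\to\mathcal{V}$ has $\underline{\mathcal{A}}(A,-)_{B,C}=\pi(\underline{\bullet}_{A,B,C})$. That $\underline\phi_{K,X,Y}$ is $\mathcal{V}$-natural in $Y$ means that the family $\varpi(\underline\phi_{K,X,Y})$,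 $Y\in\operatorname{ob}\mathcal{S}$, is a $\mathcal{V}$-natural transformation from $\underline{\mathcal{S}}(K\otimes X,-)$ to the composite $\underline{\mathcal{V}}(K,\underline{\mathcal{S}}(X,-))=\underline{\mathcal{V}}(K,-)\cdot\underline{\mathcal{S}}(X,-)$. *)

theory Defs
  imports Main
begin

section \<open>Categories and functors\<close>

record ('o, 'm) cat =
  ob :: "'o set"
  arr :: "'m set"
  src :: "'m \<Rightarrow> 'o"
  tgt :: "'m \<Rightarrow> 'o"
  idn :: "'o \<Rightarrow> 'm"
  cmp :: "'m \<Rightarrow> 'm \<Rightarrow> 'm"  (infixl "\<cdot>\<index>" 70)

definition hom :: "('o, 'm, 'z) cat_scheme \<Rightarrow> 'o \<Rightarrow> 'o \<Rightarrow> 'm set" where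
  "hom C X Y = {f \<in> arr C. src C f = X \<and> tgt C f = Y}"

locale category =
  fixes C :: "('o, 'm, 'z) cat_scheme" (structure)
  assumes src_ob: "f \<in> arr C \<Longrightarrow> src C f \<in> ob C"
    and tgt_ob: "f \<in> arr C \<Longrightarrow> tgt C f \<in> ob C"
    and idn_hom: "X \<in> ob C \<Longrightarrow> idn C X \<in> hom C X X"
    and cmp_hom: "\<lbrakk>f \<in> hom C X Y; g \<in> hom C Y Z\<rbrakk> \<Longrightarrow> g \<cdot> f \<in> hom C X Z"
    and idn_left: "f \<in> hom C X Y \<Longrightarrow> idn C Y \<cdot> f = f"
    and idn_right: "f \<in> hom C X Y \<Longrightarrow> f \<cdot> idn C X = f"
    and cmp_assoc: "\<lbrakk>f \<in> hom C X Y; g \<in> hom C Y Z; h \<in> hom C Z W\<rbrakk>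
                      \<Longrightarrow> (h \<cdot> g) \<cdot> f = h \<cdot> (g \<cdot> f)"

definition inverse_arrs :: "('o, 'm, 'z) cat_scheme \<Rightarrow> 'm \<Rightarrow> 'm \<Rightarrow> bool" where
  "inverse_arrs C f g \<longleftrightarrow> f \<in> arr C \<and> g \<in> hom C (tgt C f) (src C f) \<and>
     g \<cdot>\<^bsub>C\<^esub> f = idn C (src C f) \<and> f \<cdot>\<^bsub>C\<^esub> g = idn C (tgt C f)"

definition isos :: "('o, 'm, 'z) cat_scheme \<Rightarrow> 'o \<Rightarrow> 'o \<Rightarrow> 'm set" where
  "isos C X Y = {f \<in> hom C X Y. \<exists>g. inverse_arrs C f g}"

definition inv_arr :: "('o, 'm, 'z) cat_scheme \<Rightarrow> 'm \<Rightarrow> 'm" where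
  "inv_arr C f = (THE g. inverse_arrs C f g)"

definition op_cat :: "('o, 'm, 'z) cat_scheme \<Rightarrow> ('o, 'm) cat" where
  "op_cat C = \<lparr>ob = ob C, arr = arr C, src = tgt C, tgt = src C, idn = idn C,
               cmp = (\<lambda>g f. f \<cdot>\<^bsub>C\<^esub> g)\<rparr>"

definition prod_cat ::
  "('o, 'm, 'z) cat_scheme \<Rightarrow> ('p, 'n, 'y) cat_scheme \<Rightarrow> ('o \<times> 'p, 'm \<times> 'n) cat" where
  "prod_cat C D = \<lparr>ob = ob C \<times> ob D, arr = arr C \<times> arr D,
     src = map_prod (src C) (src D), tgt = map_prod (tgt C) (tgt D),
     idn = map_prod (idn C) (idn D),
     cmp = (\<lambda>(g, g') (f, f'). (g \<cdot>\<^bsub>C\<^esub> f, g' \<cdot>\<^bsub>D\<^esub> f'))\<rparr>"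

locale cat_functor = C: category C + D: category D
  for C :: "('o, 'm, 'z) cat_scheme" and D :: "('p, 'n, 'y) cat_scheme" +
  fixes Fo :: "'o \<Rightarrow> 'p" and Fm :: "'m \<Rightarrow> 'n"
  assumes F_ob: "X \<in> ob C \<Longrightarrow> Fo X \<in> ob D"
    and F_hom: "f \<in> hom C X Y \<Longrightarrow> Fm f \<in> hom D (Fo X) (Fo Y)"
    and F_idn: "X \<in> ob C \<Longrightarrow> Fm (idn C X) = idn D (Fo X)"
    and F_cmp: "\<lbrakk>f \<in> hom C X Y; g \<in> hom C Y Z\<rbrakk> \<Longrightarrow> Fm (g \<cdot>\<^bsub>C\<^esub> f) = Fm g \<cdot>\<^bsub>D\<^esub> Fm f"


section \<open>Closed monoidal categories\<close>

record ('o, 'm) moncat = "('o, 'm) cat" +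
  tens :: "'o \<Rightarrow> 'o \<Rightarrow> 'o"  (infixr "\<otimes>\<index>" 75)
  tensm :: "'m \<Rightarrow> 'm \<Rightarrow> 'm"  (infixr "\<otimes>\<^sub>m\<index>" 75)
  unit :: "'o"
  assc :: "'o \<Rightarrow> 'o \<Rightarrow> 'o \<Rightarrow> 'm"
  lunit :: "'o \<Rightarrow> 'm"
  runit :: "'o \<Rightarrow> 'm"

locale monoidal_category = category V
  for V :: "('o, 'm, 'z) moncat_scheme" (structure) +
  assumes tens_functor:
      "cat_functor (prod_cat V V) V (\<lambda>(X, Y). X \<otimes> Y) (\<lambda>(f, g). f \<otimes>\<^sub>m g)"
    and unit_ob: "unit V \<in> ob V"
    and assc_iso: "\<lbrakk>X \<in> ob V; Y \<in> ob V; Z \<in> ob V\<rbrakk>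
      \<Longrightarrow> assc V X Y Z \<in> isos V ((X \<otimes> Y) \<otimes> Z) (X \<otimes> (Y \<otimes> Z))"
    and assc_natural: "\<lbrakk>f \<in> hom V X X'; g \<in> hom V Y Y'; h \<in> hom V Z Z'\<rbrakk>
      \<Longrightarrow> assc V X' Y' Z' \<cdot> ((f \<otimes>\<^sub>m g) \<otimes>\<^sub>m h) = (f \<otimes>\<^sub>m (g \<otimes>\<^sub>m h)) \<cdot> assc V X Y Z"
    and lunit_iso: "X \<in> ob V \<Longrightarrow> lunit V X \<in> isos V (unit V \<otimes> X) X"
    and lunit_natural: "f \<in> hom V X Y
      \<Longrightarrow> lunit V Y \<cdot> (idn V (unit V) \<otimes>\<^sub>m f) = f \<cdot> lunit V X"
    and runit_iso: "X \<in> ob V \<Longrightarrow> runit V X \<in> isos V (X \<otimes> unit V) X"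
    and runit_natural: "f \<in> hom V X Y
      \<Longrightarrow> runit V Y \<cdot> (f \<otimes>\<^sub>m idn V (unit V)) = f \<cdot> runit V X"
    and pentagon: "\<lbrakk>W \<in> ob V; X \<in> ob V; Y \<in> ob V; Z \<in> ob V\<rbrakk>
      \<Longrightarrow> (idn V W \<otimes>\<^sub>m assc V X Y Z) \<cdot> assc V W (X \<otimes> Y) Z \<cdot> (assc V W X Y \<otimes>\<^sub>m idn V Z)
        = assc V W X (Y \<otimes> Z) \<cdot> assc V (W \<otimes> X) Y Z"
    and triangle: "\<lbrakk>X \<in> ob V; Y \<in> ob V\<rbrakk>
      \<Longrightarrow> (idn V X \<otimes>\<^sub>m lunit V Y) \<cdot> assc V X (unit V) Y = runit V X \<otimes>\<^sub>m idn V Y"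

text \<open>Here \<open>ihom V Y\<close> and \<open>ihomm V Y\<close> are the object and arrow maps of the chosen right
  adjoint of \<open>- \<otimes> Y\<close>, and \<open>trn V X Y Z\<close> is the adjunction bijection \<open>\<pi>\<close>.\<close>

record ('o, 'm) clmoncat = "('o, 'm) moncat" +
  ihom :: "'o \<Rightarrow> 'o \<Rightarrow> 'o"
  ihomm :: "'o \<Rightarrow> 'm \<Rightarrow> 'm"
  trn :: "'o \<Rightarrow> 'o \<Rightarrow> 'o \<Rightarrow> 'm \<Rightarrow> 'm"

locale closed_monoidal_category = monoidal_category V
  for V :: "('o, 'm, 'z) clmoncat_scheme" (structure) +
  assumes ihom_functor: "Y \<in> ob V \<Longrightarrow> cat_functor V V (ihom V Y) (ihomm V Y)"
    and trn_bij: "\<lbrakk>X \<in> ob V; Y \<in> ob V; Z \<in> ob V\<rbrakk>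
      \<Longrightarrow> bij_betw (trn V X Y Z) (hom V (X \<otimes> Y) Z) (hom V X (ihom V Y Z))"
    and trn_natural: "\<lbrakk>Y \<in> ob V; f \<in> hom V X' X; g \<in> hom V (X \<otimes> Y) Z; h \<in> hom V Z Z'\<rbrakk>
      \<Longrightarrow> trn V X' Y Z' (h \<cdot> g \<cdot> (f \<otimes>\<^sub>m idn V Y)) = ihomm V Y h \<cdot> trn V X Y Z g \<cdot> f"

text \<open>The counit \<open>\<epsilon>\<^sub>Z\<close> of \<open>- \<otimes> Y \<stileturn> ihom V Y\<close>; it depends on \<open>Y\<close> as well.\<close>

definition counit :: "('o, 'm, 'z) clmoncat_scheme \<Rightarrow> 'o \<Rightarrow> 'o \<Rightarrow> 'm" where
  "counit V Y Z = inv_into (hom V (ihom V Y Z \<otimes>\<^bsub>V\<^esub> Y) Z) (trn V (ihom V Y Z) Y Z)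
                    (idn V (ihom V Y Z))"

text \<open>The bijection \<open>\<varpi>\<close> and its inverse.\<close>

definition elt :: "('o, 'm, 'z) clmoncat_scheme \<Rightarrow> 'o \<Rightarrow> 'o \<Rightarrow> 'm \<Rightarrow> 'm" where
  "elt V X Y f = trn V (unit V) X Y (f \<cdot>\<^bsub>V\<^esub> lunit V X)"

definition elt_inv :: "('o, 'm, 'z) clmoncat_scheme \<Rightarrow> 'o \<Rightarrow> 'o \<Rightarrow> 'm \<Rightarrow> 'm" where
  "elt_inv V X Y = inv_into (hom V X Y) (elt V X Y)"


section \<open>Enriched categories\<close>

record ('p, 'o, 'm) vcat =
  vob :: "'p set"
  vhom :: "'p \<Rightarrow> 'p \<Rightarrow> 'o"
  vcomp :: "'p \<Rightarrow> 'p \<Rightarrow> 'p \<Rightarrow> 'm"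
  vunit :: "'p \<Rightarrow> 'm"

locale vcategory = monoidal_category V
  for V :: "('o, 'm, 'z) moncat_scheme" (structure) +
  fixes A :: "('p, 'o, 'm) vcat"
  assumes vhom_ob: "\<lbrakk>X \<in> vob A; Y \<in> vob A\<rbrakk> \<Longrightarrow> vhom A X Y \<in> ob V"
    and vcomp_hom: "\<lbrakk>X \<in> vob A; Y \<in> vob A; Z \<in> vob A\<rbrakk>
      \<Longrightarrow> vcomp A X Y Z \<in> hom V (vhom A Y Z \<otimes> vhom A X Y) (vhom A X Z)"
    and vunit_hom: "X \<in> vob A \<Longrightarrow> vunit A X \<in> hom V (unit V) (vhom A X X)"
    and vcomp_assoc: "\<lbrakk>X \<in> vob A; Y \<in> vob A; Z \<in> vob A; W \<in> vob A\<rbrakk>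
      \<Longrightarrow> vcomp A X Y W \<cdot> (vcomp A Y Z W \<otimes>\<^sub>m idn V (vhom A X Y))
        = vcomp A X Z W \<cdot> (idn V (vhom A Z W) \<otimes>\<^sub>m vcomp A X Y Z)
            \<cdot> assc V (vhom A Z W) (vhom A Y Z) (vhom A X Y)"
    and vunit_left: "\<lbrakk>X \<in> vob A; Y \<in> vob A\<rbrakk>
      \<Longrightarrow> vcomp A X Y Y \<cdot> (vunit A Y \<otimes>\<^sub>m idn V (vhom A X Y)) = lunit V (vhom A X Y)"
    and vunit_right: "\<lbrakk>X \<in> vob A; Y \<in> vob A\<rbrakk>
      \<Longrightarrow> vcomp A X X Y \<cdot> (idn V (vhom A X Y) \<otimes>\<^sub>m vunit A X) = runit V (vhom A X Y)"

record ('p, 'q, 'm) vfun =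
  vfob :: "'p \<Rightarrow> 'q"
  vfhom :: "'p \<Rightarrow> 'p \<Rightarrow> 'm"

locale vfunctor = A: vcategory V A + B: vcategory V B
  for V :: "('o, 'm, 'z) moncat_scheme" (structure)
    and A :: "('p, 'o, 'm) vcat" and B :: "('q, 'o, 'm) vcat" +
  fixes T :: "('p, 'q, 'm) vfun"
  assumes vfob_ob: "X \<in> vob A \<Longrightarrow> vfob T X \<in> vob B"
    and vfhom_hom: "\<lbrakk>X \<in> vob A; Y \<in> vob A\<rbrakk>
      \<Longrightarrow> vfhom T X Y \<in> hom V (vhom A X Y) (vhom B (vfob T X) (vfob T Y))"
    and vfhom_comp: "\<lbrakk>X \<in> vob A; Y \<in> vob A; Z \<in> vob A\<rbrakk>
      \<Longrightarrow> vfhom T X Z \<cdot> vcomp A X Y Z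
        = vcomp B (vfob T X) (vfob T Y) (vfob T Z) \<cdot> (vfhom T Y Z \<otimes>\<^sub>m vfhom T X Y)"
    and vfhom_unit: "X \<in> vob A \<Longrightarrow> vfhom T X X \<cdot> vunit A X = vunit B (vfob T X)"

definition vfun_comp ::
  "('o, 'm, 'z) moncat_scheme \<Rightarrow> ('q, 'r, 'm) vfun \<Rightarrow> ('p, 'q, 'm) vfun \<Rightarrow> ('p, 'r, 'm) vfun" where
  "vfun_comp V G F = \<lparr>vfob = (\<lambda>X. vfob G (vfob F X)),
     vfhom = (\<lambda>X Y. vfhom G (vfob F X) (vfob F Y) \<cdot>\<^bsub>V\<^esub> vfhom F X Y)\<rparr>"

locale vnatural = S: vfunctor V A B S + T: vfunctor V A B T
  for V :: "('o, 'm, 'z) moncat_scheme" (structure)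
    and A :: "('p, 'o, 'm) vcat" and B :: "('q, 'o, 'm) vcat"
    and S :: "('p, 'q, 'm) vfun" and T :: "('p, 'q, 'm) vfun" +
  fixes \<alpha> :: "'p \<Rightarrow> 'm"
  assumes component_hom: "X \<in> vob A \<Longrightarrow> \<alpha> X \<in> hom V (unit V) (vhom B (vfob S X) (vfob T X))"
    and vnaturality: "\<lbrakk>X \<in> vob A; Y \<in> vob A\<rbrakk>
      \<Longrightarrow> vcomp B (vfob S X) (vfob S Y) (vfob T Y) \<cdot> (\<alpha> Y \<otimes>\<^sub>m vfhom S X Y)
            \<cdot> inv_arr V (lunit V (vhom A X Y))
        = vcomp B (vfob S X) (vfob T X) (vfob T Y) \<cdot> (vfhom T X Y \<otimes>\<^sub>m \<alpha> X)
            \<cdot> inv_arr V (runit V (vhom A X Y))"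

text \<open>A closed monoidal category as a category enriched in itself.\<close>

definition self_vcat :: "('o, 'm, 'z) clmoncat_scheme \<Rightarrow> ('o, 'o, 'm) vcat" where
  "self_vcat V = \<lparr>vob = ob V, vhom = ihom V,
     vcomp = (\<lambda>X Y Z. trn V (ihom V Y Z \<otimes>\<^bsub>V\<^esub> ihom V X Y) X Z
       (counit V Y Z \<cdot>\<^bsub>V\<^esub> (idn V (ihom V Y Z) \<otimes>\<^sub>m\<^bsub>V\<^esub> counit V X Y)
         \<cdot>\<^bsub>V\<^esub> assc V (ihom V Y Z) (ihom V X Y) X)),
     vunit = (\<lambda>X. elt V X X (idn V X))\<rparr>"

text \<open>The representable \<open>V\<close>-functor \<open>A(X, -)\<close>, with values in \<open>self_vcat V\<close>.\<close>

definition rep_vfun ::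
  "('o, 'm, 'z) clmoncat_scheme \<Rightarrow> ('p, 'o, 'm) vcat \<Rightarrow> 'p \<Rightarrow> ('p, 'o, 'm) vfun" where
  "rep_vfun V A X = \<lparr>vfob = vhom A X,
     vfhom = (\<lambda>Y Z. trn V (vhom A Y Z) (vhom A X Y) (vhom A X Z) (vcomp A X Y Z))\<rparr>"

locale tensored = V: closed_monoidal_category V + A: vcategory V A
  for V :: "('o, 'm, 'z) clmoncat_scheme" and A :: "('p, 'o, 'm) vcat" +
  fixes T :: "'o \<Rightarrow> 'p \<Rightarrow> 'p" and \<phi> :: "'o \<Rightarrow> 'p \<Rightarrow> 'p \<Rightarrow> 'm"
  assumes T_ob: "\<lbrakk>K \<in> ob V; X \<in> vob A\<rbrakk> \<Longrightarrow> T K X \<in> vob A"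
    and \<phi>_iso: "\<lbrakk>K \<in> ob V; X \<in> vob A; Y \<in> vob A\<rbrakk>
      \<Longrightarrow> \<phi> K X Y \<in> isos V (vhom A (T K X) Y) (ihom V K (vhom A X Y))"
    and \<phi>_vnatural: "\<lbrakk>K \<in> ob V; X \<in> vob A\<rbrakk>
      \<Longrightarrow> vnatural V A (self_vcat V) (rep_vfun V A (T K X))
            (vfun_comp V (rep_vfun V (self_vcat V) K) (rep_vfun V A X))
            (\<lambda>Y. elt V (vhom A (T K X) Y) (ihom V K (vhom A X Y)) (\<phi> K X Y))"


section \<open>Categories with a \<open>V\<close>-structure\<close>

text \<open>\<open>shom\<close> and \<open>shomm\<close> are the object and arrow maps of the functor
  \<open>S\<^sup>o\<^sup>p \<times> S \<rightarrow> V\<close>. The component of \<open>el\<close> (\<open>\<phi>\<close> in the literature) at \<open>(X, Y)\<close> is its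
  restriction to \<open>hom S X Y\<close>; no indices are needed since hom-sets are disjoint.\<close>

record ('p, 'n, 'o, 'm) vstrcat = "('p, 'n) cat" +
  shom :: "'p \<Rightarrow> 'p \<Rightarrow> 'o"
  shomm :: "'n \<Rightarrow> 'n \<Rightarrow> 'm"
  scomp :: "'p \<Rightarrow> 'p \<Rightarrow> 'p \<Rightarrow> 'm"
  el :: "'n \<Rightarrow> 'm"

locale category_with_vstructure = V: monoidal_category V + S: category S
  for V :: "('o, 'm, 'z) moncat_scheme" (structure)
    and S :: "('p, 'n, 'o, 'm) vstrcat" +
  assumes shom_functor: "cat_functor (prod_cat (op_cat S) S) V
      (\<lambda>(X, Y). shom S X Y) (\<lambda>(f, g). shomm S f g)"
    and scomp_hom: "\<lbrakk>X \<in> ob S; Y \<in> ob S; Z \<in> ob S\<rbrakk>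
      \<Longrightarrow> scomp S X Y Z \<in> hom V (shom S Y Z \<otimes> shom S X Y) (shom S X Z)"
    and el_bij: "\<lbrakk>X \<in> ob S; Y \<in> ob S\<rbrakk>
      \<Longrightarrow> bij_betw (el S) (hom S X Y) (hom V (unit V) (shom S X Y))"
    and el_natural: "\<lbrakk>f \<in> hom S X' X; h \<in> hom S X Y; g \<in> hom S Y Y'\<rbrakk>
      \<Longrightarrow> el S (g \<cdot>\<^bsub>S\<^esub> h \<cdot>\<^bsub>S\<^esub> f) = shomm S f g \<cdot> el S h"
    and scomp_assoc: "\<lbrakk>X \<in> ob S; Y \<in> ob S; Z \<in> ob S; W \<in> ob S\<rbrakk>
      \<Longrightarrow> scomp S X Y W \<cdot> (scomp S Y Z W \<otimes>\<^sub>m idn V (shom S X Y))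
        = scomp S X Z W \<cdot> (idn V (shom S Z W) \<otimes>\<^sub>m scomp S X Y Z)
            \<cdot> assc V (shom S Z W) (shom S Y Z) (shom S X Y)"
    and shomm_left: "\<lbrakk>f \<in> hom S X Y; Z \<in> ob S\<rbrakk>
      \<Longrightarrow> shomm S f (idn S Z)
        = scomp S X Y Z \<cdot> (idn V (shom S Y Z) \<otimes>\<^sub>m el S f) \<cdot> inv_arr V (runit V (shom S Y Z))"
    and shomm_right: "\<lbrakk>X \<in> ob S; g \<in> hom S Y Z\<rbrakk>
      \<Longrightarrow> shomm S (idn S X) g
        = scomp S X Y Z \<cdot> (el S g \<otimes>\<^sub>m idn V (shom S X Y)) \<cdot> inv_arr V (lunit V (shom S X Y))"

definition assoc_vcat :: "('p, 'n, 'o, 'm) vstrcat \<Rightarrow> ('p, 'o, 'm) vcat" where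
  "assoc_vcat S = \<lparr>vob = ob S, vhom = shom S, vcomp = scomp S,
                   vunit = (\<lambda>X. el S (idn S X))\<rparr>"

text \<open>\<open>cylinder V S K X KX \<alpha> \<phi>\<close>: the triple \<open>(KX, \<alpha>, \<phi>)\<close> is a \<open>K\<close>-cylinder of \<open>X\<close>.\<close>

definition cylinder ::
  "('o, 'm, 'z) clmoncat_scheme \<Rightarrow> ('p, 'n, 'o, 'm) vstrcat \<Rightarrow> 'o \<Rightarrow> 'p
     \<Rightarrow> 'p \<Rightarrow> 'm \<Rightarrow> ('p \<Rightarrow> 'm) \<Rightarrow> bool" where
  "cylinder V S K X KX \<alpha> \<phi> \<longleftrightarrow>
     KX \<in> ob S \<and> \<alpha> \<in> hom V K (shom S X KX) \<and>
     (\<forall>Y \<in> ob S. \<phi> Y \<in> isos V (shom S KX Y) (ihom V K (shom S X Y)) \<and>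
        counit V K (shom S X Y) \<cdot>\<^bsub>V\<^esub> (\<phi> Y \<otimes>\<^sub>m\<^bsub>V\<^esub> idn V K)
          = scomp S X KX Y \<cdot>\<^bsub>V\<^esub> (idn V (shom S KX Y) \<otimes>\<^sub>m\<^bsub>V\<^esub> \<alpha>))"

definition has_cylinder ::
  "('o, 'm, 'z) clmoncat_scheme \<Rightarrow> ('p, 'n, 'o, 'm) vstrcat
     \<Rightarrow> ('o \<Rightarrow> 'p \<Rightarrow> 'p) \<Rightarrow> ('o \<Rightarrow> 'p \<Rightarrow> 'm) \<Rightarrow> ('o \<Rightarrow> 'p \<Rightarrow> 'p \<Rightarrow> 'm) \<Rightarrow> bool" where
  "has_cylinder V S T \<alpha> \<phi> \<longleftrightarrow>
     (\<forall>K \<in> ob V. \<forall>X \<in> ob S. cylinder V S K X (T K X) (\<alpha> K X) (\<phi> K X))"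

end

theory Submission
  imports Defs
begin

text \<open>Transposing twice along the tensor-hom adjunction turns the \<open>V\<close>-naturality of \<open>\<phi>\<close> into an
  equation between morphisms \<open>(S(Y, Z) \<otimes> S(K \<otimes> X, Y)) \<otimes> K \<rightarrow> S(X, Z)\<close>: the transpose of \<open>\<phi>\<close> commutes
  with composition on the left by elements of \<open>S(Y, Z)\<close>. If the transpose of \<open>\<phi>\<close> is composition with
  \<open>\<alpha>\<close>, as in a cylinder, this is associativity of composition. Conversely, putting \<open>Y = K \<otimes> X\<close> and
  evaluating at the unit of \<open>K \<otimes> X\<close> shows, as in the Yoneda lemma, that the transpose of \<open>\<phi>\<close> is
  composition with the element \<open>\<phi> \<cdot> j\<close>.\<close>

section \<open>Categories: typing of arrows, inverses and cancellation\<close>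

context category
begin

text \<open>Membership in a hom-set is split into conditions on \<open>src\<close> and
  \<open>tgt\<close>, so that the simplifier can check by itself that composites are well
  typed.\<close>

lemma hom_iff: "f \<in> hom C X Y \<longleftrightarrow> f \<in> arr C \<and> src C f = X \<and> tgt C f = Y"
  by (simp add: hom_def)

lemma idn_arr [simp]:
  assumes "X \<in> ob C"
  shows "idn C X \<in> arr C" "src C (idn C X) = X" "tgt C (idn C X) = X"
  using idn_hom [OF assms] by (simp_all add: hom_iff)

lemma cmp_arr [simp]:
  assumes "f \<in> arr C" "g \<in> arr C" "tgt C f = src C g"
  shows "g \<cdot> f \<in> arr C" "src C (g \<cdot> f) = src C f" "tgt C (g \<cdot> f) = tgt C g"
  using cmp_hom [of f "src C f" "src C g" g "tgt C g"] assms by (simp_all add: hom_iff)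

lemma arr_ob [simp]:
  assumes "f \<in> arr C"
  shows "src C f \<in> ob C" "tgt C f \<in> ob C"
  using assms by (simp_all add: src_ob tgt_ob)

lemma idn_cmp [simp]: "\<lbrakk>f \<in> arr C; tgt C f = Y\<rbrakk> \<Longrightarrow> idn C Y \<cdot> f = f"
  using idn_left [of f "src C f" Y] by (simp add: hom_iff)

lemma cmp_idn [simp]: "\<lbrakk>f \<in> arr C; src C f = X\<rbrakk> \<Longrightarrow> f \<cdot> idn C X = f"
  using idn_right [of f X "tgt C f"] by (simp add: hom_iff)

lemma cmp_assoc_arr [simp]:
  "\<lbrakk>f \<in> arr C; g \<in> arr C; h \<in> arr C; tgt C f = src C g; tgt C g = src C h\<rbrakk>
    \<Longrightarrow> (h \<cdot> g) \<cdot> f = h \<cdot> (g \<cdot> f)"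
  using cmp_assoc by (simp add: hom_iff)

lemma inverse_arrs_unique:
  assumes "inverse_arrs C f g" "inverse_arrs C f h"
  shows "g = h"
proof -
  have "g = (h \<cdot> f) \<cdot> g"
    using assms by (simp add: inverse_arrs_def hom_iff)
  also have "\<dots> = h \<cdot> (f \<cdot> g)"
    using assms by (subst cmp_assoc_arr) (auto simp: inverse_arrs_def hom_iff)
  also have "\<dots> = h"
    using assms by (simp add: inverse_arrs_def hom_iff)
  finally show ?thesis .
qed

lemma inv_arr_works:
  assumes "f \<in> isos C X Y"
  shows "f \<in> arr C" "src C f = X" "tgt C f = Y"
    "inv_arr C f \<in> arr C" "src C (inv_arr C f) = Y" "tgt C (inv_arr C f) = X"
    "inv_arr C f \<cdot> f = idn C X" "f \<cdot> inv_arr C f = idn C Y"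
proof -
  obtain g where g: "inverse_arrs C f g"
    using assms by (auto simp: isos_def)
  have "inverse_arrs C f (inv_arr C f)"
    unfolding inv_arr_def by (rule theI, rule g, rule inverse_arrs_unique [OF _ g])
  then show "f \<in> arr C" "src C f = X" "tgt C f = Y"
    "inv_arr C f \<in> arr C" "src C (inv_arr C f) = Y" "tgt C (inv_arr C f) = X"
    "inv_arr C f \<cdot> f = idn C X" "f \<cdot> inv_arr C f = idn C Y"
    using assms by (auto simp: isos_def inverse_arrs_def hom_iff)
qed

lemma isosI:
  assumes "f \<in> arr C" "src C f = X" "tgt C f = Y" "g \<in> arr C" "src C g = Y" "tgt C g = X"
    "g \<cdot> f = idn C X" "f \<cdot> g = idn C Y"
  shows "f \<in> isos C X Y"
  using assms by (auto simp: isos_def inverse_arrs_def hom_iff)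

text \<open>Several equations below are proved after precomposing both sides with an isomorphism;
  this removes it again.\<close>

lemma cmp_cancel_right:
  assumes "e \<in> isos C X Y" "f \<in> arr C" "g \<in> arr C" "src C f = Y" "src C g = Y"
    and eq: "f \<cdot> e = g \<cdot> e"
  shows "f = g"
proof -
  note e [simp] = inv_arr_works [OF assms(1)]
  have "(f \<cdot> e) \<cdot> inv_arr C e = (g \<cdot> e) \<cdot> inv_arr C e"
    using eq by simp
  then show ?thesis
    using assms(2-5) by simp
qed

end

section \<open>Monoidal categories: interchange and left unit coherence\<close>

context monoidal_category
begin

lemma tens_ob [simp]: "\<lbrakk>X \<in> ob V; Y \<in> ob V\<rbrakk> \<Longrightarrow> X \<otimes> Y \<in> ob V"
  using cat_functor.F_ob [OF tens_functor, of "(X, Y)"] by (simp add: prod_cat_def)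

lemma unit_ob' [simp]: "unit V \<in> ob V"
  by (rule unit_ob)

lemma tensm_arr [simp]:
  assumes "f \<in> arr V" "g \<in> arr V"
  shows "f \<otimes>\<^sub>m g \<in> arr V" "src V (f \<otimes>\<^sub>m g) = src V f \<otimes> src V g"
    "tgt V (f \<otimes>\<^sub>m g) = tgt V f \<otimes> tgt V g"
  using cat_functor.F_hom [OF tens_functor,
      of "(f, g)" "(src V f, src V g)" "(tgt V f, tgt V g)"] assms
  by (simp_all add: prod_cat_def hom_def)

lemma tensm_idn [simp]: "\<lbrakk>X \<in> ob V; Y \<in> ob V\<rbrakk> \<Longrightarrow> idn V X \<otimes>\<^sub>m idn V Y = idn V (X \<otimes> Y)"
  using cat_functor.F_idn [OF tens_functor, of "(X, Y)"] by (simp add: prod_cat_def)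

lemma interchange [simp]:
  assumes "f \<in> arr V" "g \<in> arr V" "f' \<in> arr V" "g' \<in> arr V"
    "tgt V f = src V g" "tgt V f' = src V g'"
  shows "(g \<otimes>\<^sub>m g') \<cdot> (f \<otimes>\<^sub>m f') = (g \<cdot> f) \<otimes>\<^sub>m (g' \<cdot> f')"
  using cat_functor.F_cmp [OF tens_functor,
      of "(f, f')" "(src V f, src V f')" "(tgt V f, tgt V f')" "(g, g')" "(tgt V g, tgt V g')"]
    assms
  by (simp add: prod_cat_def hom_def)

text \<open>Associativity rewrites composites to right-nested form, where two neighbouring tensor
  products are followed by a tail \<open>h\<close>; \<open>interchange\<close> alone does not match
  there.\<close>

lemma interchange_cmp [simp]:
  assumes "f \<in> arr V" "g \<in> arr V" "f' \<in> arr V" "g' \<in> arr V" "h \<in> arr V"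
    "tgt V f = src V g" "tgt V f' = src V g'" "tgt V h = src V f \<otimes> src V f'"
  shows "(g \<otimes>\<^sub>m g') \<cdot> ((f \<otimes>\<^sub>m f') \<cdot> h) = ((g \<cdot> f) \<otimes>\<^sub>m (g' \<cdot> f')) \<cdot> h"
  using assms by (simp flip: cmp_assoc_arr)

lemmas assc_arr [simp] = inv_arr_works(1-3) [OF assc_iso]
lemmas lunit_arr [simp] = inv_arr_works [OF lunit_iso]
lemmas runit_arr [simp] = inv_arr_works [OF runit_iso]

lemma tensm_isos:
  assumes "f \<in> isos V X Y" "f' \<in> isos V X' Y'"
  shows "f \<otimes>\<^sub>m f' \<in> isos V (X \<otimes> X') (Y \<otimes> Y')"
proof -
  note f [simp] = inv_arr_works [OF assms(1)] and f' [simp] = inv_arr_works [OF assms(2)]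
  have [simp]: "X \<in> ob V" "Y \<in> ob V" "X' \<in> ob V" "Y' \<in> ob V"
    using f(1-3) f'(1-3) arr_ob by metis+
  show ?thesis
    by (rule isosI [where g = "inv_arr V f \<otimes>\<^sub>m inv_arr V f'"]) simp_all
qed

lemma idn_isos: "X \<in> ob V \<Longrightarrow> idn V X \<in> isos V X X"
  by (rule isosI [where g = "idn V X"]) simp_all

lemma assc_nat:
  assumes "f \<in> arr V" "g \<in> arr V" "h \<in> arr V" "tgt V f = X" "tgt V g = Y" "tgt V h = Z"
  shows "assc V X Y Z \<cdot> ((f \<otimes>\<^sub>m g) \<otimes>\<^sub>m h) = (f \<otimes>\<^sub>m (g \<otimes>\<^sub>m h)) \<cdot> assc V (src V f) (src V g) (src V h)"
  using assms assc_natural [of f "src V f" X g "src V g" Y h "src V h" Z] by (simp add: hom_iff)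

lemma lunit_nat:
  "\<lbrakk>f \<in> arr V; tgt V f = Y\<rbrakk> \<Longrightarrow> lunit V Y \<cdot> (idn V (unit V) \<otimes>\<^sub>m f) = f \<cdot> lunit V (src V f)"
  using lunit_natural [of f "src V f" Y] by (simp add: hom_iff)

text \<open>Naturality of \<open>lunit\<close> expresses \<open>f \<cdot> lunit V X\<close> through
  the tensor product of \<open>f\<close> with the unit, and \<open>lunit\<close> is
  invertible.\<close>

lemma tensm_unit_faithful:
  assumes "f \<in> arr V" "g \<in> arr V" "src V f = src V g" "tgt V f = tgt V g"
    and eq: "idn V (unit V) \<otimes>\<^sub>m f = idn V (unit V) \<otimes>\<^sub>m g"
  shows "f = g"
proof (rule cmp_cancel_right)
  show "lunit V (src V g) \<in> isos V (unit V \<otimes> src V g) (src V g)"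
    using assms by (intro lunit_iso) simp
  show "f \<cdot> lunit V (src V g) = g \<cdot> lunit V (src V g)"
    using assms lunit_nat [of f "tgt V g"] lunit_nat [of g "tgt V g"] by simp
qed (use assms in simp_all)

text \<open>Kelly's redundancy of the left unit coherence: after tensoring with the unit on the left
  it follows from the pentagon and the triangle.\<close>

lemma lunit_tens:
  assumes [simp]: "X \<in> ob V" "Y \<in> ob V"
  shows "lunit V (X \<otimes> Y) \<cdot> assc V (unit V) X Y = lunit V X \<otimes>\<^sub>m idn V Y"
proof (rule tensm_unit_faithful)
  let ?I = "unit V"
  \<comment> \<open>\<open>?e\<close> consists of the first two associators on the three-arrow side
    of the pentagon at \<open>I, I, X, Y\<close>. The equation is proved after precomposing with
    them, and they are then cancelled one after the other.\<close>
  let ?e = "assc V ?I (?I \<otimes> X) Y \<cdot> (assc V ?I ?I X \<otimes>\<^sub>m idn V Y)"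
  have pent: "(idn V ?I \<otimes>\<^sub>m assc V ?I X Y) \<cdot> ?e = assc V ?I ?I (X \<otimes> Y) \<cdot> assc V (?I \<otimes> ?I) X Y"
    using pentagon [of ?I ?I X Y] by simp
  let ?l = "(idn V ?I \<otimes>\<^sub>m (lunit V (X \<otimes> Y) \<cdot> assc V ?I X Y)) \<cdot> assc V ?I (?I \<otimes> X) Y"
  let ?r = "(idn V ?I \<otimes>\<^sub>m (lunit V X \<otimes>\<^sub>m idn V Y)) \<cdot> assc V ?I (?I \<otimes> X) Y"
  have "?l = ?r"
  proof (rule cmp_cancel_right)
    show "assc V ?I ?I X \<otimes>\<^sub>m idn V Y \<in> isos V (((?I \<otimes> ?I) \<otimes> X) \<otimes> Y) ((?I \<otimes> (?I \<otimes> X)) \<otimes> Y)"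
      by (intro tensm_isos assc_iso idn_isos) simp_all
    have "?l \<cdot> (assc V ?I ?I X \<otimes>\<^sub>m idn V Y)
        = (idn V ?I \<otimes>\<^sub>m lunit V (X \<otimes> Y)) \<cdot> ((idn V ?I \<otimes>\<^sub>m assc V ?I X Y) \<cdot> ?e)"
      by simp
    also have "\<dots> = ((idn V ?I \<otimes>\<^sub>m lunit V (X \<otimes> Y)) \<cdot> assc V ?I ?I (X \<otimes> Y)) \<cdot> assc V (?I \<otimes> ?I) X Y"
      unfolding pent by simp
    \<comment> \<open>The triangle at \<open>I, X \<otimes> Y\<close> leaves
      \<open>runit V ?I\<close> tensored with an identity, and naturality moves it past the
      associator. The next line uses the triangle at \<open>I, X\<close> to return to
      \<open>lunit V X\<close>.\<close>
    also have "\<dots> = assc V ?I X Y \<cdot> ((runit V ?I \<otimes>\<^sub>m idn V X) \<otimes>\<^sub>m idn V Y)"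
      by (subst triangle) (simp_all add: assc_nat)
    also have "\<dots> = (assc V ?I X Y \<cdot> ((idn V ?I \<otimes>\<^sub>m lunit V X) \<otimes>\<^sub>m idn V Y))
        \<cdot> (assc V ?I ?I X \<otimes>\<^sub>m idn V Y)"
      by (simp flip: triangle)
    also have "\<dots> = ?r \<cdot> (assc V ?I ?I X \<otimes>\<^sub>m idn V Y)"
      by (subst assc_nat) simp_all
    finally show "?l \<cdot> (assc V ?I ?I X \<otimes>\<^sub>m idn V Y) = ?r \<cdot> (assc V ?I ?I X \<otimes>\<^sub>m idn V Y)" .
  qed simp_all
  then show "idn V ?I \<otimes>\<^sub>m (lunit V (X \<otimes> Y) \<cdot> assc V ?I X Y) = idn V ?I \<otimes>\<^sub>m (lunit V X \<otimes>\<^sub>m idn V Y)"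
    by (rule cmp_cancel_right [OF assc_iso [of ?I "?I \<otimes> X" Y], rotated -1]) simp_all
qed simp_all

end

section \<open>Closed monoidal categories: evaluation, elements and the self-enrichment\<close>

context closed_monoidal_category
begin

lemma ihom_ob [simp]: "\<lbrakk>Y \<in> ob V; Z \<in> ob V\<rbrakk> \<Longrightarrow> ihom V Y Z \<in> ob V"
  by (rule cat_functor.F_ob [OF ihom_functor])

lemma trn_arr [simp]:
  assumes "X \<in> ob V" "Y \<in> ob V" "g \<in> arr V" "src V g = X \<otimes> Y" "tgt V g = Z"
  shows "trn V X Y Z g \<in> arr V" "src V (trn V X Y Z g) = X" "tgt V (trn V X Y Z g) = ihom V Y Z"
proof -
  have "Z \<in> ob V"
    using assms by auto
  then show "trn V X Y Z g \<in> arr V" "src V (trn V X Y Z g) = X"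
    "tgt V (trn V X Y Z g) = ihom V Y Z"
    using bij_betwE [OF trn_bij [of X Y Z]] assms by (simp_all add: hom_iff)
qed

text \<open>This is the joint naturality of \<pi> with \<open>h\<close> an identity, which
  \<open>ihomm\<close> preserves.\<close>

lemma trn_cmp:
  assumes "Y \<in> ob V" "f \<in> arr V" "tgt V f = X" "g \<in> arr V" "src V g = X \<otimes> Y" "tgt V g = Z"
  shows "trn V (src V f) Y Z (g \<cdot> (f \<otimes>\<^sub>m idn V Y)) = trn V X Y Z g \<cdot> f"
proof -
  have [simp]: "X \<in> ob V" "Z \<in> ob V"
    using assms by auto
  have "ihomm V Y (idn V Z) = idn V (ihom V Y Z)"
    by (rule cat_functor.F_idn [OF ihom_functor]) (simp_all add: assms)
  then show ?thesis
    using trn_natural [of Y f "src V f" X g Z "idn V Z" Z] assms by (simp add: hom_iff)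
qed

lemma counit_arr [simp]:
  assumes [simp]: "Y \<in> ob V" "Z \<in> ob V"
  shows "counit V Y Z \<in> arr V" "src V (counit V Y Z) = ihom V Y Z \<otimes> Y" "tgt V (counit V Y Z) = Z"
    and trn_counit: "trn V (ihom V Y Z) Y Z (counit V Y Z) = idn V (ihom V Y Z)"
proof -
  have bij: "bij_betw (trn V (ihom V Y Z) Y Z) (hom V (ihom V Y Z \<otimes> Y) Z)
      (hom V (ihom V Y Z) (ihom V Y Z))"
    by (rule trn_bij) simp_all
  have idn: "idn V (ihom V Y Z) \<in> hom V (ihom V Y Z) (ihom V Y Z)"
    by (simp add: hom_iff)
  have "counit V Y Z \<in> hom V (ihom V Y Z \<otimes> Y) Z"
    unfolding counit_def
    by (rule inv_into_into) (simp add: bij_betw_imp_surj_on [OF bij] idn)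
  then show "counit V Y Z \<in> arr V" "src V (counit V Y Z) = ihom V Y Z \<otimes> Y"
    "tgt V (counit V Y Z) = Z"
    by (simp_all add: hom_iff)
  show "trn V (ihom V Y Z) Y Z (counit V Y Z) = idn V (ihom V Y Z)"
    unfolding counit_def using bij idn by (rule bij_betw_inv_into_right)
qed

lemma trn_counit_tens:
  assumes "Y \<in> ob V" "Z \<in> ob V" "f \<in> arr V" "tgt V f = ihom V Y Z"
  shows "trn V (src V f) Y Z (counit V Y Z \<cdot> (f \<otimes>\<^sub>m idn V Y)) = f"
  using assms by (simp add: trn_cmp trn_counit)

text \<open>Universal property of evaluation: by \<open>trn_counit_tens\<close> a morphism into
  \<open>ihom V Y Z\<close> is recovered from its composite with the counit. The enriched identities
  below are checked by evaluating both sides in this way.\<close>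

lemma ihom_eqI:
  assumes "Y \<in> ob V" "Z \<in> ob V" "f \<in> arr V" "g \<in> arr V" "src V f = src V g"
    "tgt V f = ihom V Y Z" "tgt V g = ihom V Y Z"
    "counit V Y Z \<cdot> (f \<otimes>\<^sub>m idn V Y) = counit V Y Z \<cdot> (g \<otimes>\<^sub>m idn V Y)"
  shows "f = g"
  using trn_counit_tens [of Y Z f] trn_counit_tens [of Y Z g] assms by metis

lemma ihom_eq_iff:
  assumes "Y \<in> ob V" "Z \<in> ob V" "f \<in> arr V" "g \<in> arr V" "src V f = src V g"
    "tgt V f = ihom V Y Z" "tgt V g = ihom V Y Z"
  shows "f = g \<longleftrightarrow> counit V Y Z \<cdot> (f \<otimes>\<^sub>m idn V Y) = counit V Y Z \<cdot> (g \<otimes>\<^sub>m idn V Y)"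
  using ihom_eqI [OF assms] by blast

text \<open>Both sides have the same transpose by \<open>trn_counit_tens\<close>, and transposition
  is injective.\<close>

lemma counit_trn_idn:
  assumes [simp]: "X \<in> ob V" "Y \<in> ob V" "g \<in> arr V" "src V g = X \<otimes> Y" "tgt V g = Z"
  shows "counit V Y Z \<cdot> (trn V X Y Z g \<otimes>\<^sub>m idn V Y) = g"
proof -
  have [simp]: "Z \<in> ob V"
    using arr_ob [OF assms(3)] unfolding assms(5) by blast
  have "trn V X Y Z (counit V Y Z \<cdot> (trn V X Y Z g \<otimes>\<^sub>m idn V Y)) = trn V X Y Z g"
    using trn_counit_tens [of Y Z "trn V X Y Z g"] by simp
  moreover have "inj_on (trn V X Y Z) (hom V (X \<otimes> Y) Z)"
    by (rule bij_betw_imp_inj_on, rule trn_bij) simp_all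
  ultimately show ?thesis
    by (simp add: inj_on_def hom_iff)
qed

text \<open>Form for rewriting: with general \<open>h\<close> and \<open>k\<close> the rule still
  applies after interchange has merged neighbouring factors into the two slots.\<close>

lemma counit_trn_cmp:
  assumes [simp]: "g \<in> arr V" "src V g = X \<otimes> Y" "tgt V g = Z" "X \<in> ob V" "Y \<in> ob V"
    "h \<in> arr V" "tgt V h = X" "k \<in> arr V" "tgt V k = Y"
  shows "counit V Y Z \<cdot> ((trn V X Y Z g \<cdot> h) \<otimes>\<^sub>m k) = g \<cdot> (h \<otimes>\<^sub>m k)"
proof -
  have [simp]: "Z \<in> ob V"
    using arr_ob [OF assms(1)] unfolding assms(3) by blast
  have "g \<cdot> (h \<otimes>\<^sub>m k) = (counit V Y Z \<cdot> (trn V X Y Z g \<otimes>\<^sub>m idn V Y)) \<cdot> (h \<otimes>\<^sub>m k)"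
    by (subst counit_trn_idn) simp_all
  then show ?thesis
    by simp
qed

lemma counit_trn:
  assumes [simp]: "g \<in> arr V" "src V g = X \<otimes> Y" "tgt V g = Z" "X \<in> ob V" "Y \<in> ob V"
    "k \<in> arr V" "tgt V k = Y"
  shows "counit V Y Z \<cdot> (trn V X Y Z g \<otimes>\<^sub>m k) = g \<cdot> (idn V X \<otimes>\<^sub>m k)"
  using counit_trn_cmp [of g X Y Z "idn V X" k] by simp

lemma elt_arr [simp]:
  assumes "f \<in> arr V" "src V f = X" "tgt V f = Y"
  shows "elt V X Y f \<in> arr V" "src V (elt V X Y f) = unit V" "tgt V (elt V X Y f) = ihom V X Y"
proof -
  have [simp]: "X \<in> ob V" "Y \<in> ob V"
    using assms by auto
  show "elt V X Y f \<in> arr V" "src V (elt V X Y f) = unit V" "tgt V (elt V X Y f) = ihom V X Y"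
    using assms by (simp_all add: elt_def)
qed

text \<open>The counit cancels the transpose in the definition of \<open>elt\<close>; naturality of
  the left unitor then carries it past \<open>k\<close>, which is why it is taken at the source of
  \<open>k\<close>.\<close>

lemma counit_elt:
  assumes [simp]: "f \<in> arr V" "src V f = X" "tgt V f = Y"
    "k \<in> arr V" "tgt V k = X"
  shows "counit V X Y \<cdot> (elt V X Y f \<otimes>\<^sub>m k) = f \<cdot> k \<cdot> lunit V (src V k)"
proof -
  have [simp]: "X \<in> ob V" "Y \<in> ob V"
    using arr_ob [OF assms(1)] unfolding assms(2,3) by blast+
  show ?thesis
    by (simp add: elt_def counit_trn lunit_nat)
qed

lemma elt_inv_works:
  assumes "X \<in> ob V" "Y \<in> ob V" "g \<in> arr V" "src V g = unit V" "tgt V g = ihom V X Y"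
  shows "elt_inv V X Y g \<in> arr V" "src V (elt_inv V X Y g) = X" "tgt V (elt_inv V X Y g) = Y"
    "elt V X Y (elt_inv V X Y g) = g"
proof -
  note [simp] = assms
  \<comment> \<open>\<open>?f\<close> undoes the transposition and the left unitor in the definition
    of \<open>elt\<close>. Hence \<open>g\<close> lies in the image of \<varpi>, and
    \<open>inv_into\<close> returns a genuine preimage.\<close>
  let ?f = "counit V X Y \<cdot> (g \<otimes>\<^sub>m idn V X) \<cdot> inv_arr V (lunit V X)"
  have "g = elt V X Y ?f"
    using trn_counit_tens [of X Y g] by (simp add: elt_def)
  moreover have "?f \<in> hom V X Y"
    by (simp add: hom_iff)
  ultimately have "g \<in> elt V X Y ` hom V X Y"
    by blast
  then have "elt_inv V X Y g \<in> hom V X Y" "elt V X Y (elt_inv V X Y g) = g"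
    unfolding elt_inv_def by (rule inv_into_into, rule f_inv_into_f)
  then show "elt_inv V X Y g \<in> arr V" "src V (elt_inv V X Y g) = X"
    "tgt V (elt_inv V X Y g) = Y" "elt V X Y (elt_inv V X Y g) = g"
    by (simp_all add: hom_iff)
qed

lemma self_vcat_simps [simp]:
  "vob (self_vcat V) = ob V" "vhom (self_vcat V) = ihom V"
  "vunit (self_vcat V) X = elt V X X (idn V X)"
  by (simp_all add: self_vcat_def)

lemma self_comp_arr [simp]:
  assumes "X \<in> ob V" "Y \<in> ob V" "Z \<in> ob V"
  shows "vcomp (self_vcat V) X Y Z \<in> arr V"
    "src V (vcomp (self_vcat V) X Y Z) = ihom V Y Z \<otimes> ihom V X Y"
    "tgt V (vcomp (self_vcat V) X Y Z) = ihom V X Z"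
  using assms by (simp_all add: self_vcat_def)

text \<open>Composition in \<open>self_vcat V\<close> is the transpose of evaluating twice, so the
  outer counit cancels it; naturality of the associator then moves \<open>p\<close>,
  \<open>q\<close> and \<open>k\<close> inside.\<close>

lemma counit_self_comp:
  assumes [simp]: "X \<in> ob V" "Y \<in> ob V" "Z \<in> ob V"
    "p \<in> arr V" "q \<in> arr V" "k \<in> arr V"
    "tgt V p = ihom V Y Z" "tgt V q = ihom V X Y" "tgt V k = X"
  shows "counit V X Z \<cdot> ((vcomp (self_vcat V) X Y Z \<cdot> (p \<otimes>\<^sub>m q)) \<otimes>\<^sub>m k)
    = counit V Y Z \<cdot> (p \<otimes>\<^sub>m (counit V X Y \<cdot> (q \<otimes>\<^sub>m k))) \<cdot> assc V (src V p) (src V q) (src V k)"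
  by (simp add: self_vcat_def counit_trn_cmp assc_nat)

text \<open>When \<open>p\<close> and \<open>q\<close> are identities the simplifier erases their
  tensor product, so composition standing alone needs its own rule.\<close>

lemma counit_self_comp':
  assumes [simp]: "X \<in> ob V" "Y \<in> ob V" "Z \<in> ob V" "k \<in> arr V" "tgt V k = X"
  shows "counit V X Z \<cdot> (vcomp (self_vcat V) X Y Z \<otimes>\<^sub>m k)
    = counit V Y Z \<cdot> (idn V (ihom V Y Z) \<otimes>\<^sub>m (counit V X Y \<cdot> (idn V (ihom V X Y) \<otimes>\<^sub>m k)))
        \<cdot> assc V (ihom V Y Z) (ihom V X Y) (src V k)"
  using counit_self_comp [of X Y Z "idn V (ihom V Y Z)" "idn V (ihom V X Y)" k] by simp

text \<open>After evaluation the left unit law becomes \<open>lunit_tens\<close>, the right unit law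
  the triangle, and associativity the pentagon.\<close>

lemma vcategory_self_vcat: "vcategory V (self_vcat V)"
proof (intro vcategory.intro vcategory_axioms.intro monoidal_category_axioms;
    (simp only: self_vcat_simps)?)
  let ?M = "vcomp (self_vcat V)"
  fix X Y assume [simp]: "X \<in> ob V" "Y \<in> ob V"
  show "ihom V X Y \<in> ob V"
    by simp
  show "?M X Y Z \<in> hom V (ihom V Y Z \<otimes> ihom V X Y) (ihom V X Z)" if "Z \<in> ob V" for Z
    using that by (simp add: hom_iff)
  show "elt V X X (idn V X) \<in> hom V (unit V) (ihom V X X)"
    by (simp add: hom_iff)
  show "?M X Y Y \<cdot> (elt V Y Y (idn V Y) \<otimes>\<^sub>m idn V (ihom V X Y)) = lunit V (ihom V X Y)"
    by (rule ihom_eqI [of X Y])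
      (simp_all add: counit_self_comp counit_elt lunit_tens)
  show "?M X X Y \<cdot> (idn V (ihom V X Y) \<otimes>\<^sub>m elt V X X (idn V X)) = runit V (ihom V X Y)"
    by (rule ihom_eqI [of X Y])
      (simp_all add: counit_self_comp counit_elt flip: triangle)
  fix Z W assume [simp]: "Z \<in> ob V" "W \<in> ob V"
  let ?A = "ihom V Z W" and ?B = "ihom V Y Z" and ?C = "ihom V X Y"
  show "?M X Y W \<cdot> (?M Y Z W \<otimes>\<^sub>m idn V ?C) = ?M X Z W \<cdot> (idn V ?A \<otimes>\<^sub>m ?M X Y Z) \<cdot> assc V ?A ?B ?C"
  proof (rule ihom_eqI [of X W])
    have "counit V X W \<cdot> ((?M X Z W \<cdot> (idn V ?A \<otimes>\<^sub>m ?M X Y Z) \<cdot> assc V ?A ?B ?C) \<otimes>\<^sub>m idn V X)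
        = (counit V X W \<cdot> ((?M X Z W \<cdot> (idn V ?A \<otimes>\<^sub>m ?M X Y Z)) \<otimes>\<^sub>m idn V X))
            \<cdot> (assc V ?A ?B ?C \<otimes>\<^sub>m idn V X)"
      by simp
    \<comment> \<open>Evaluating the right-hand side gives three nested counits after the
      three-arrow side of the pentagon at \<open>?A\<close>, \<open>?B\<close>, \<open>?C\<close>,
      \<open>X\<close>. Once the pentagon has been applied, the remaining steps recognise the
      evaluated left-hand side.\<close>
    also have "\<dots> = (counit V Z W \<cdot> (idn V ?A \<otimes>\<^sub>m (counit V Y Z \<cdot> (idn V ?B \<otimes>\<^sub>m counit V X Y))))
        \<cdot> ((idn V ?A \<otimes>\<^sub>m assc V ?B ?C X) \<cdot> assc V ?A (?B \<otimes> ?C) X \<cdot> (assc V ?A ?B ?C \<otimes>\<^sub>m idn V X))"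
      by (subst counit_self_comp) (simp_all add: counit_self_comp')
    also have "\<dots> = (counit V Z W \<cdot> (idn V ?A \<otimes>\<^sub>m (counit V Y Z \<cdot> (idn V ?B \<otimes>\<^sub>m counit V X Y))))
        \<cdot> (assc V ?A ?B (?C \<otimes> X) \<cdot> assc V (?A \<otimes> ?B) ?C X)"
      by (subst pentagon) simp_all
    also have "\<dots> = counit V Y W \<cdot> (?M Y Z W \<otimes>\<^sub>m counit V X Y) \<cdot> assc V (?A \<otimes> ?B) ?C X"
      using counit_self_comp' [of Y Z W "counit V X Y"]
      by (simp flip: cmp_assoc_arr)
    also have "\<dots> = counit V X W \<cdot> ((?M X Y W \<cdot> (?M Y Z W \<otimes>\<^sub>m idn V ?C)) \<otimes>\<^sub>m idn V X)"
      by (subst counit_self_comp) simp_all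
    finally show "counit V X W \<cdot> ((?M X Y W \<cdot> (?M Y Z W \<otimes>\<^sub>m idn V ?C)) \<otimes>\<^sub>m idn V X)
      = counit V X W \<cdot> ((?M X Z W \<cdot> (idn V ?A \<otimes>\<^sub>m ?M X Y Z) \<cdot> assc V ?A ?B ?C) \<otimes>\<^sub>m idn V X)" ..
  qed simp_all
qed

lemma self_comp_elt_left:
  assumes [simp]: "f \<in> arr V" "src V f = Y" "tgt V f = Z" "X \<in> ob V"
    "h \<in> arr V" "src V h = H" "tgt V h = ihom V X Y"
  shows "counit V X Z \<cdot> ((vcomp (self_vcat V) X Y Z \<cdot> (elt V Y Z f \<otimes>\<^sub>m h) \<cdot> inv_arr V (lunit V H))
        \<otimes>\<^sub>m idn V X)
    = f \<cdot> counit V X Y \<cdot> (h \<otimes>\<^sub>m idn V X)"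
proof -
  have [simp]: "Y \<in> ob V" "Z \<in> ob V" "H \<in> ob V"
    using arr_ob [OF assms(1)] arr_ob [OF assms(5)] unfolding assms(2,3,6) by blast+
  have "counit V X Z \<cdot> ((vcomp (self_vcat V) X Y Z \<cdot> (elt V Y Z f \<otimes>\<^sub>m h) \<cdot> inv_arr V (lunit V H))
        \<otimes>\<^sub>m idn V X)
      = (counit V X Z \<cdot> ((vcomp (self_vcat V) X Y Z \<cdot> (elt V Y Z f \<otimes>\<^sub>m h)) \<otimes>\<^sub>m idn V X))
          \<cdot> (inv_arr V (lunit V H) \<otimes>\<^sub>m idn V X)"
    by simp
  also have "\<dots> = f \<cdot> (counit V X Y \<cdot> (h \<otimes>\<^sub>m idn V X))
      \<cdot> (lunit V (H \<otimes> X) \<cdot> assc V (unit V) H X) \<cdot> (inv_arr V (lunit V H) \<otimes>\<^sub>m idn V X)"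
    by (subst counit_self_comp) (simp_all add: counit_elt flip: cmp_assoc_arr)
  also have "\<dots> = f \<cdot> counit V X Y \<cdot> (h \<otimes>\<^sub>m idn V X)"
    \<comment> \<open>Reassociation is switched off first, since it would break up the bracket to
      which \<open>lunit_tens\<close> applies.\<close>
    by (simp add: lunit_tens del: cmp_assoc_arr) simp
  finally show ?thesis .
qed

text \<open>Counterpart for the right side of naturality: \<open>f\<close> now acts on the argument
  of the evaluation instead of its result, and the triangle takes the place of
  \<open>lunit_tens\<close>.\<close>

lemma self_comp_elt_right:
  assumes [simp]: "f \<in> arr V" "src V f = X" "tgt V f = Y" "Z \<in> ob V"
    "h \<in> arr V" "src V h = H" "tgt V h = ihom V Y Z"
  shows "counit V X Z \<cdot> ((vcomp (self_vcat V) X Y Z \<cdot> (h \<otimes>\<^sub>m elt V X Y f) \<cdot> inv_arr V (runit V H))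
        \<otimes>\<^sub>m idn V X)
    = counit V Y Z \<cdot> (h \<otimes>\<^sub>m f)"
proof -
  have [simp]: "X \<in> ob V" "Y \<in> ob V" "H \<in> ob V"
    using arr_ob [OF assms(1)] arr_ob [OF assms(5)] unfolding assms(2,3,6) by blast+
  have "counit V X Z \<cdot> ((vcomp (self_vcat V) X Y Z \<cdot> (h \<otimes>\<^sub>m elt V X Y f) \<cdot> inv_arr V (runit V H))
        \<otimes>\<^sub>m idn V X)
      = (counit V X Z \<cdot> ((vcomp (self_vcat V) X Y Z \<cdot> (h \<otimes>\<^sub>m elt V X Y f)) \<otimes>\<^sub>m idn V X))
          \<cdot> (inv_arr V (runit V H) \<otimes>\<^sub>m idn V X)"
    by simp
  also have "\<dots> = counit V Y Z \<cdot> (h \<otimes>\<^sub>m f)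
      \<cdot> ((idn V H \<otimes>\<^sub>m lunit V X) \<cdot> assc V H (unit V) X) \<cdot> (inv_arr V (runit V H) \<otimes>\<^sub>m idn V X)"
    by (subst counit_self_comp) (simp_all add: counit_elt)
  also have "\<dots> = counit V Y Z \<cdot> (h \<otimes>\<^sub>m f)"
    by (subst triangle) simp_all
  finally show ?thesis .
qed

end

section \<open>Enriched categories, representables and naturality\<close>

context vcategory
begin

lemma vcomp_arr [simp]:
  assumes "X \<in> vob A" "Y \<in> vob A" "Z \<in> vob A"
  shows "vcomp A X Y Z \<in> arr V" "src V (vcomp A X Y Z) = vhom A Y Z \<otimes> vhom A X Y"
    "tgt V (vcomp A X Y Z) = vhom A X Z"
  using vcomp_hom [OF assms] by (simp_all add: hom_iff)

lemma vunit_arr [simp]: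
  assumes "X \<in> vob A"
  shows "vunit A X \<in> arr V" "src V (vunit A X) = unit V" "tgt V (vunit A X) = vhom A X X"
  using vunit_hom [OF assms] by (simp_all add: hom_iff)

declare vhom_ob [simp]

end

context vfunctor
begin

lemma vfhom_arr [simp]:
  assumes "X \<in> vob A" "Y \<in> vob A"
  shows "vfhom T X Y \<in> arr V" "src V (vfhom T X Y) = vhom A X Y"
    "tgt V (vfhom T X Y) = vhom B (vfob T X) (vfob T Y)"
  using vfhom_hom [OF assms] by (simp_all add: A.hom_iff)

declare vfob_ob [simp]

end

lemma vfunctor_vfun_comp:
  assumes "vfunctor V A B F" "vfunctor V B C G"
  shows "vfunctor V A C (vfun_comp V G F)"
proof -
  interpret F: vfunctor V A B F by fact
  interpret G: vfunctor V B C G by fact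
  show ?thesis
  proof (intro vfunctor.intro vfunctor_axioms.intro F.A.vcategory_axioms G.B.vcategory_axioms)
    fix X Y Z assume [simp]: "X \<in> vob A" "Y \<in> vob A" "Z \<in> vob A"
    let ?C = "vcomp C (vfob G (vfob F X)) (vfob G (vfob F Y)) (vfob G (vfob F Z))"
    have "(vfhom G (vfob F X) (vfob F Z) \<cdot>\<^bsub>V\<^esub> vfhom F X Z) \<cdot>\<^bsub>V\<^esub> vcomp A X Y Z
      = (vfhom G (vfob F X) (vfob F Z) \<cdot>\<^bsub>V\<^esub> vcomp B (vfob F X) (vfob F Y) (vfob F Z))
          \<cdot>\<^bsub>V\<^esub> (vfhom F Y Z \<otimes>\<^sub>m\<^bsub>V\<^esub> vfhom F X Y)"
      by (simp add: F.vfhom_comp)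
    then show "vfhom (vfun_comp V G F) X Z \<cdot>\<^bsub>V\<^esub> vcomp A X Y Z
      = vcomp C (vfob (vfun_comp V G F) X) (vfob (vfun_comp V G F) Y) (vfob (vfun_comp V G F) Z)
          \<cdot>\<^bsub>V\<^esub> (vfhom (vfun_comp V G F) Y Z \<otimes>\<^sub>m\<^bsub>V\<^esub> vfhom (vfun_comp V G F) X Y)"
      by (simp add: vfun_comp_def G.vfhom_comp)
  qed (auto simp: vfun_comp_def F.A.hom_iff F.vfhom_unit G.vfhom_unit)
qed

text \<open>This combination is used also with \<open>self_vcat V\<close> in place of
  \<open>A\<close>, so that the facts on representables cover \<open>V(K, -)\<close>.\<close>

locale closed_vcategory = closed_monoidal_category V + vcategory V A
  for V :: "('o, 'm, 'z) clmoncat_scheme" (structure) and A :: "('p, 'o, 'm) vcat"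
begin

lemma rep_vfun_simps [simp]:
  "vfob (rep_vfun V A X) = vhom A X"
  "vfhom (rep_vfun V A X) Y Z = trn V (vhom A Y Z) (vhom A X Y) (vhom A X Z) (vcomp A X Y Z)"
  by (simp_all add: rep_vfun_def)

text \<open>After evaluation, compatibility with composition is \<open>vcomp_assoc\<close> and
  preservation of units is \<open>vunit_left\<close>.\<close>

lemma vfunctor_rep_vfun:
  assumes [simp]: "X \<in> vob A"
  shows "vfunctor V A (self_vcat V) (rep_vfun V A X)"
proof (intro vfunctor.intro vfunctor_axioms.intro vcategory_axioms vcategory_self_vcat)
  fix Y assume [simp]: "Y \<in> vob A"
  show "vfob (rep_vfun V A X) Y \<in> vob (self_vcat V)"
    by simp
  show "vfhom (rep_vfun V A X) Y Y \<cdot> vunit A Y = vunit (self_vcat V) (vfob (rep_vfun V A X) Y)"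
    by (rule ihom_eqI [of "vhom A X Y" "vhom A X Y"])
      (simp_all add: counit_trn_cmp counit_elt vunit_left)
  fix Z assume [simp]: "Z \<in> vob A"
  show "vfhom (rep_vfun V A X) Y Z \<in> hom V (vhom A Y Z)
      (vhom (self_vcat V) (vfob (rep_vfun V A X) Y) (vfob (rep_vfun V A X) Z))"
    by (simp add: hom_iff)
  fix W assume [simp]: "W \<in> vob A"
  show "vfhom (rep_vfun V A X) Y W \<cdot> vcomp A Y Z W
    = vcomp (self_vcat V) (vfob (rep_vfun V A X) Y) (vfob (rep_vfun V A X) Z) (vfob (rep_vfun V A X) W)
        \<cdot> (vfhom (rep_vfun V A X) Z W \<otimes>\<^sub>m vfhom (rep_vfun V A X) Y Z)"
    by (rule ihom_eqI [of "vhom A X Y" "vhom A X W"])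
      (simp_all add: counit_trn_cmp counit_self_comp counit_trn vcomp_assoc)
qed

text \<open>Both sides of the naturality condition are morphisms from \<open>A(Y, Z)\<close> to
  \<open>V(A(T, Y), V(K, A(X, Z)))\<close>. Two uses of \<open>ihom_eq_iff\<close>, first over
  \<open>A(T, Y)\<close> and then over \<open>K\<close>, remove the two internal homs.\<close>

lemma vnatural_rep_iff:
  assumes [simp]: "K \<in> ob V" "X \<in> vob A" "T \<in> vob A"
    and \<phi> [simp]: "\<And>Y. Y \<in> vob A \<Longrightarrow> \<phi> Y \<in> arr V" "\<And>Y. Y \<in> vob A \<Longrightarrow> src V (\<phi> Y) = vhom A T Y"
      "\<And>Y. Y \<in> vob A \<Longrightarrow> tgt V (\<phi> Y) = ihom V K (vhom A X Y)"
  shows "vnatural V A (self_vcat V) (rep_vfun V A T)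
            (vfun_comp V (rep_vfun V (self_vcat V) K) (rep_vfun V A X))
            (\<lambda>Y. elt V (vhom A T Y) (ihom V K (vhom A X Y)) (\<phi> Y))
    \<longleftrightarrow> (\<forall>Y\<in>vob A. \<forall>Z\<in>vob A.
          counit V K (vhom A X Z) \<cdot> ((\<phi> Z \<cdot> vcomp A T Y Z) \<otimes>\<^sub>m idn V K)
        = vcomp A X Y Z \<cdot> (idn V (vhom A Y Z) \<otimes>\<^sub>m (counit V K (vhom A X Y) \<cdot> (\<phi> Y \<otimes>\<^sub>m idn V K)))
            \<cdot> assc V (vhom A Y Z) (vhom A T Y) K)"
    (is "vnatural V A _ _ ?G ?\<alpha> \<longleftrightarrow> _")
proof -
  have self: "closed_vcategory V (self_vcat V)"
    by (intro closed_vcategory.intro closed_monoidal_category_axioms vcategory_self_vcat)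
  note self_rep [simp] = closed_vcategory.rep_vfun_simps [OF self]
  have G: "vfunctor V A (self_vcat V) ?G"
    by (rule vfunctor_vfun_comp [OF vfunctor_rep_vfun closed_vcategory.vfunctor_rep_vfun [OF self]])
      simp_all
  have "(vcomp (self_vcat V) (vhom A T Y) (vhom A T Z) (vfob ?G Z)
            \<cdot> (?\<alpha> Z \<otimes>\<^sub>m vfhom (rep_vfun V A T) Y Z) \<cdot> inv_arr V (lunit V (vhom A Y Z))
        = vcomp (self_vcat V) (vhom A T Y) (vfob ?G Y) (vfob ?G Z)
            \<cdot> (vfhom ?G Y Z \<otimes>\<^sub>m ?\<alpha> Y) \<cdot> inv_arr V (runit V (vhom A Y Z)))
      \<longleftrightarrow> counit V K (vhom A X Z) \<cdot> ((\<phi> Z \<cdot> vcomp A T Y Z) \<otimes>\<^sub>m idn V K)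
        = vcomp A X Y Z \<cdot> (idn V (vhom A Y Z) \<otimes>\<^sub>m (counit V K (vhom A X Y) \<cdot> (\<phi> Y \<otimes>\<^sub>m idn V K)))
            \<cdot> assc V (vhom A Y Z) (vhom A T Y) K"
      (is "?L = ?R \<longleftrightarrow> ?l = ?r")
    if [simp]: "Y \<in> vob A" "Z \<in> vob A" for Y Z
  proof -
    \<comment> \<open>\<open>?N\<close> composes, inside \<open>self_vcat V\<close>, the morphism
      \<open>\<phi> Y\<close> with the action of \<open>A(X, -)\<close> on \<open>A(Y, Z)\<close>.
      It is what the right side becomes after the first evaluation.\<close>
    let ?N = "vcomp (self_vcat V) K (vhom A X Y) (vhom A X Z) \<cdot> (vfhom (rep_vfun V A X) Y Z \<otimes>\<^sub>m \<phi> Y)"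
    have "?L = ?R \<longleftrightarrow> counit V (vhom A T Y) (ihom V K (vhom A X Z)) \<cdot> (?L \<otimes>\<^sub>m idn V (vhom A T Y))
        = counit V (vhom A T Y) (ihom V K (vhom A X Z)) \<cdot> (?R \<otimes>\<^sub>m idn V (vhom A T Y))"
      by (rule ihom_eq_iff) (simp_all add: vfun_comp_def)
    also have "counit V (vhom A T Y) (ihom V K (vhom A X Z)) \<cdot> (?L \<otimes>\<^sub>m idn V (vhom A T Y))
        = \<phi> Z \<cdot> vcomp A T Y Z"
      using self_comp_elt_left [of "\<phi> Z" "vhom A T Z" "ihom V K (vhom A X Z)" "vhom A T Y"
          "vfhom (rep_vfun V A T) Y Z" "vhom A Y Z"]
      by (simp add: vfun_comp_def counit_trn)
    also have "counit V (vhom A T Y) (ihom V K (vhom A X Z)) \<cdot> (?R \<otimes>\<^sub>m idn V (vhom A T Y)) = ?N"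
      using self_comp_elt_right [of "\<phi> Y" "vhom A T Y" "ihom V K (vhom A X Y)"
          "ihom V K (vhom A X Z)" "vfhom ?G Y Z" "vhom A Y Z"]
      by (simp add: vfun_comp_def counit_trn_cmp)
    also have "\<phi> Z \<cdot> vcomp A T Y Z = ?N \<longleftrightarrow> ?l = counit V K (vhom A X Z) \<cdot> (?N \<otimes>\<^sub>m idn V K)"
      by (rule ihom_eq_iff) simp_all
    also have "counit V K (vhom A X Z) \<cdot> (?N \<otimes>\<^sub>m idn V K) = ?r"
      by (simp add: counit_self_comp counit_trn)
    finally show ?thesis .
  qed
  then show ?thesis
    using G vfunctor_rep_vfun [of T]
    by (auto simp: vnatural_def vnatural_axioms_def hom_iff vfun_comp_def)
qed

text \<open>\<open>cyl\<close> replaces the transpose of \<open>\<phi>\<close> on both sides of the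
  criterion \<open>vnatural_rep_iff\<close>; what remains is associativity of composition together
  with naturality of the associator in \<open>\<alpha>\<close>.\<close>

lemma cylinder_imp_vnatural:
  assumes [simp]: "K \<in> ob V" "X \<in> vob A" "T \<in> vob A"
    and \<phi> [simp]: "\<And>Y. Y \<in> vob A \<Longrightarrow> \<phi> Y \<in> arr V" "\<And>Y. Y \<in> vob A \<Longrightarrow> src V (\<phi> Y) = vhom A T Y"
      "\<And>Y. Y \<in> vob A \<Longrightarrow> tgt V (\<phi> Y) = ihom V K (vhom A X Y)"
    and \<alpha> [simp]: "\<alpha> \<in> arr V" "src V \<alpha> = K" "tgt V \<alpha> = vhom A X T"
    and cyl: "\<And>Y. Y \<in> vob A \<Longrightarrow> counit V K (vhom A X Y) \<cdot> (\<phi> Y \<otimes>\<^sub>m idn V K)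
        = vcomp A X T Y \<cdot> (idn V (vhom A T Y) \<otimes>\<^sub>m \<alpha>)"
  shows "vnatural V A (self_vcat V) (rep_vfun V A T)
            (vfun_comp V (rep_vfun V (self_vcat V) K) (rep_vfun V A X))
            (\<lambda>Y. elt V (vhom A T Y) (ihom V K (vhom A X Y)) (\<phi> Y))"
proof (subst vnatural_rep_iff; (intro ballI)?)
  fix Y Z assume [simp]: "Y \<in> vob A" "Z \<in> vob A"
  let ?A = "vhom A Y Z" and ?B = "vhom A T Y"
  have "counit V K (vhom A X Z) \<cdot> ((\<phi> Z \<cdot> vcomp A T Y Z) \<otimes>\<^sub>m idn V K)
      = (counit V K (vhom A X Z) \<cdot> (\<phi> Z \<otimes>\<^sub>m idn V K)) \<cdot> (vcomp A T Y Z \<otimes>\<^sub>m idn V K)"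
    by simp
  \<comment> \<open>Composition and \<open>\<alpha>\<close> act on different tensor factors, so
    interchange lets \<open>\<alpha>\<close> act first.\<close>
  also have "\<dots> = (vcomp A X T Z \<cdot> (vcomp A T Y Z \<otimes>\<^sub>m idn V (vhom A X T))) \<cdot> (idn V (?A \<otimes> ?B) \<otimes>\<^sub>m \<alpha>)"
    by (simp add: cyl)
  also have "\<dots> = vcomp A X Y Z \<cdot> (idn V ?A \<otimes>\<^sub>m vcomp A X T Y)
      \<cdot> (assc V ?A ?B (vhom A X T) \<cdot> ((idn V ?A \<otimes>\<^sub>m idn V ?B) \<otimes>\<^sub>m \<alpha>))"
    by (simp add: vcomp_assoc)
  also have "\<dots> = vcomp A X Y Z \<cdot> (idn V ?A \<otimes>\<^sub>m (vcomp A X T Y \<cdot> (idn V ?B \<otimes>\<^sub>m \<alpha>))) \<cdot> assc V ?A ?B K"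
    by (subst assc_nat) simp_all
  finally show "counit V K (vhom A X Z) \<cdot> ((\<phi> Z \<cdot> vcomp A T Y Z) \<otimes>\<^sub>m idn V K)
      = vcomp A X Y Z \<cdot> (idn V ?A \<otimes>\<^sub>m (counit V K (vhom A X Y) \<cdot> (\<phi> Y \<otimes>\<^sub>m idn V K))) \<cdot> assc V ?A ?B K"
    by (simp add: cyl)
qed simp_all

text \<open>The Yoneda argument: specialise the naturality square to the tensor itself and evaluate at
  its unit.\<close>

lemma vnatural_imp_cylinder:
  assumes [simp]: "K \<in> ob V" "X \<in> vob A" "T \<in> vob A" "Z \<in> vob A"
    and \<phi> [simp]: "\<And>Y. Y \<in> vob A \<Longrightarrow> \<phi> Y \<in> arr V" "\<And>Y. Y \<in> vob A \<Longrightarrow> src V (\<phi> Y) = vhom A T Y"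
      "\<And>Y. Y \<in> vob A \<Longrightarrow> tgt V (\<phi> Y) = ihom V K (vhom A X Y)"
    and \<alpha> [simp]: "\<alpha> \<in> arr V" "src V \<alpha> = K" "tgt V \<alpha> = vhom A X T"
    and elt_\<alpha>: "elt V K (vhom A X T) \<alpha> = \<phi> T \<cdot> vunit A T"
    and nat: "vnatural V A (self_vcat V) (rep_vfun V A T)
            (vfun_comp V (rep_vfun V (self_vcat V) K) (rep_vfun V A X))
            (\<lambda>Y. elt V (vhom A T Y) (ihom V K (vhom A X Y)) (\<phi> Y))"
  shows "counit V K (vhom A X Z) \<cdot> (\<phi> Z \<otimes>\<^sub>m idn V K) = vcomp A X T Z \<cdot> (idn V (vhom A T Z) \<otimes>\<^sub>m \<alpha>)"
proof (rule cmp_cancel_right)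
  \<comment> \<open>\<open>?J\<close> inserts the unit of \<open>T\<close>. By the right unit law,
    precomposing with \<open>runit V ?A \<otimes>\<^sub>m idn V K\<close> amounts to
    \<open>?J\<close> followed by composition, which is the shape the naturality criterion
    rewrites.\<close>
  let ?A = "vhom A T Z" and ?J = "(idn V (vhom A T Z) \<otimes>\<^sub>m vunit A T) \<otimes>\<^sub>m idn V K"
  show "runit V ?A \<otimes>\<^sub>m idn V K \<in> isos V ((?A \<otimes> unit V) \<otimes> K) (?A \<otimes> K)"
    by (intro tensm_isos runit_iso idn_isos) simp_all
  have "(counit V K (vhom A X Z) \<cdot> (\<phi> Z \<otimes>\<^sub>m idn V K)) \<cdot> (runit V ?A \<otimes>\<^sub>m idn V K)
      = (counit V K (vhom A X Z) \<cdot> ((\<phi> Z \<cdot> vcomp A T T Z) \<otimes>\<^sub>m idn V K)) \<cdot> ?J"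
    by (simp add: vunit_right)
  \<comment> \<open>The criterion is used at the pair \<open>T\<close>, \<open>Z\<close>.\<close>
  also have "\<dots> = (vcomp A X T Z
      \<cdot> (idn V ?A \<otimes>\<^sub>m (counit V K (vhom A X T) \<cdot> (\<phi> T \<otimes>\<^sub>m idn V K))) \<cdot> assc V ?A (vhom A T T) K) \<cdot> ?J"
    using nat by (subst (asm) vnatural_rep_iff) simp_all
  also have "\<dots> = vcomp A X T Z
      \<cdot> (idn V ?A \<otimes>\<^sub>m (counit V K (vhom A X T) \<cdot> ((\<phi> T \<cdot> vunit A T) \<otimes>\<^sub>m idn V K))) \<cdot> assc V ?A (unit V) K"
    by (simp add: assc_nat)
  \<comment> \<open>By \<open>elt_\<alpha>\<close> the element being evaluated comes from
    \<open>\<alpha>\<close>, so its evaluation is \<open>\<alpha>\<close> after a left unitor; the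
    triangle then produces the right unitor to be cancelled.\<close>
  also have "\<dots> = vcomp A X T Z \<cdot> (idn V ?A \<otimes>\<^sub>m \<alpha>) \<cdot> ((idn V ?A \<otimes>\<^sub>m lunit V K) \<cdot> assc V ?A (unit V) K)"
    by (simp add: counit_elt flip: elt_\<alpha>)
  also have "\<dots> = (vcomp A X T Z \<cdot> (idn V ?A \<otimes>\<^sub>m \<alpha>)) \<cdot> (runit V ?A \<otimes>\<^sub>m idn V K)"
    by (subst triangle) simp_all
  finally show "(counit V K (vhom A X Z) \<cdot> (\<phi> Z \<otimes>\<^sub>m idn V K)) \<cdot> (runit V ?A \<otimes>\<^sub>m idn V K)
      = (vcomp A X T Z \<cdot> (idn V ?A \<otimes>\<^sub>m \<alpha>)) \<cdot> (runit V ?A \<otimes>\<^sub>m idn V K)" .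
qed simp_all

end

section \<open>Categories with a V-structure; cylinders and tensors\<close>

lemma assoc_vcat_simps [simp]:
  "vob (assoc_vcat S) = ob S" "vhom (assoc_vcat S) = shom S" "vcomp (assoc_vcat S) = scomp S"
  "vunit (assoc_vcat S) X = el S (idn S X)"
  by (simp_all add: assoc_vcat_def)

context category_with_vstructure
begin

lemma shom_ob [simp]: "\<lbrakk>X \<in> ob S; Y \<in> ob S\<rbrakk> \<Longrightarrow> shom S X Y \<in> ob V"
  using cat_functor.F_ob [OF shom_functor, of "(X, Y)"] by (simp add: prod_cat_def op_cat_def)

lemma shomm_idn: "\<lbrakk>X \<in> ob S; Y \<in> ob S\<rbrakk> \<Longrightarrow> shomm S (idn S X) (idn S Y) = idn V (shom S X Y)"
  using cat_functor.F_idn [OF shom_functor, of "(X, Y)"] by (simp add: prod_cat_def op_cat_def)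

lemma scomp_arr [simp]:
  assumes "X \<in> ob S" "Y \<in> ob S" "Z \<in> ob S"
  shows "scomp S X Y Z \<in> arr V" "src V (scomp S X Y Z) = shom S Y Z \<otimes> shom S X Y"
    "tgt V (scomp S X Y Z) = shom S X Z"
  using scomp_hom [OF assms] by (simp_all add: V.hom_iff)

lemma el_idn_arr [simp]:
  assumes "X \<in> ob S"
  shows "el S (idn S X) \<in> arr V" "src V (el S (idn S X)) = unit V"
    "tgt V (el S (idn S X)) = shom S X X"
  using bij_betwE [OF el_bij [of X X]] assms by (auto simp: V.hom_iff S.hom_iff)

text \<open>Associativity is an axiom of the structure. The unit laws are the formulas for
  \<open>shomm\<close> at identities: functoriality makes \<open>shomm\<close> of two identities an
  identity, and composing with the unitor removes its inverse.\<close>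

lemma vcategory_assoc_vcat: "vcategory V (assoc_vcat S)"
proof (intro vcategory.intro vcategory_axioms.intro V.monoidal_category_axioms;
    (simp only: assoc_vcat_simps)?)
  fix X Y assume [simp]: "X \<in> ob S" "Y \<in> ob S"
  let ?A = "shom S X Y"
  show "scomp S X Y Y \<cdot> (el S (idn S Y) \<otimes>\<^sub>m idn V ?A) = lunit V ?A"
  proof -
    have "lunit V ?A = (scomp S X Y Y \<cdot> (el S (idn S Y) \<otimes>\<^sub>m idn V ?A) \<cdot> inv_arr V (lunit V ?A)) \<cdot> lunit V ?A"
      by (subst shomm_right [symmetric]) (simp_all add: shomm_idn S.hom_iff)
    then show ?thesis
      by simp
  qed
  show "scomp S X X Y \<cdot> (idn V ?A \<otimes>\<^sub>m el S (idn S X)) = runit V ?A"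
  proof -
    have "runit V ?A = (scomp S X X Y \<cdot> (idn V ?A \<otimes>\<^sub>m el S (idn S X)) \<cdot> inv_arr V (runit V ?A)) \<cdot> runit V ?A"
      by (subst shomm_left [symmetric]) (simp_all add: shomm_idn S.hom_iff)
    then show ?thesis
      by simp
  qed
qed (simp_all add: V.hom_iff scomp_assoc)

end

theorem theorem1p8:
  fixes V :: "('o, 'm) clmoncat" and S :: "('p, 'n, 'o, 'm) vstrcat"
  assumes "closed_monoidal_category V" and "category_with_vstructure V S"
  shows "(\<forall>T \<alpha> \<phi>. has_cylinder V S T \<alpha> \<phi> \<longrightarrow> tensored V (assoc_vcat S) T \<phi>)
    \<and> (\<forall>T \<phi>. tensored V (assoc_vcat S) T \<phi> \<longrightarrow>
          has_cylinder V S T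
            (\<lambda>K X. elt_inv V K (shom S X (T K X))
                     (\<phi> K X (T K X) \<cdot>\<^bsub>V\<^esub> vunit (assoc_vcat S) (T K X)))
            \<phi>)"
proof -
  note vcat = category_with_vstructure.vcategory_assoc_vcat [OF assms(2)]
  interpret A: closed_vcategory V "assoc_vcat S"
    by (intro closed_vcategory.intro assms(1) vcat)
  interpret S: category_with_vstructure V S by fact
  have "tensored V (assoc_vcat S) T \<phi>" if cyl: "has_cylinder V S T \<alpha> \<phi>" for T \<alpha> \<phi>
  proof (intro tensored.intro tensored_axioms.intro assms(1) vcat)
    fix K X assume KX: "K \<in> ob V" "X \<in> vob (assoc_vcat S)"
    then have c: "cylinder V S K X (T K X) (\<alpha> K X) (\<phi> K X)"
      using cyl by (simp add: has_cylinder_def)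
    then show T: "T K X \<in> vob (assoc_vcat S)"
      by (simp add: cylinder_def)
    show iso: "\<phi> K X Y \<in> isos V (vhom (assoc_vcat S) (T K X) Y) (ihom V K (vhom (assoc_vcat S) X Y))"
      if "Y \<in> vob (assoc_vcat S)" for Y
      using c that by (simp add: cylinder_def)
    \<comment> \<open>The object and the isomorphisms belong to the cylinder; only naturality needs
      the transposed criterion.\<close>
    show "vnatural V (assoc_vcat S) (self_vcat V) (rep_vfun V (assoc_vcat S) (T K X))
        (vfun_comp V (rep_vfun V (self_vcat V) K) (rep_vfun V (assoc_vcat S) X))
        (\<lambda>Y. elt V (vhom (assoc_vcat S) (T K X) Y) (ihom V K (vhom (assoc_vcat S) X Y)) (\<phi> K X Y))"
      using c A.inv_arr_works(1-3) [OF iso]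
      by (intro A.cylinder_imp_vnatural [OF KX T, where \<alpha> = "\<alpha> K X"])
        (simp_all add: cylinder_def A.hom_iff)
  qed
  moreover have "has_cylinder V S T (\<lambda>K X. elt_inv V K (shom S X (T K X))
      (\<phi> K X (T K X) \<cdot>\<^bsub>V\<^esub> vunit (assoc_vcat S) (T K X))) \<phi>"
    if "tensored V (assoc_vcat S) T \<phi>" for T \<phi>
  proof -
    interpret T: tensored V "assoc_vcat S" T \<phi> by fact
    show ?thesis
      unfolding has_cylinder_def cylinder_def
    proof (intro ballI conjI)
      fix K X assume KX [simp]: "K \<in> ob V" "X \<in> ob S"
      have T [simp]: "T K X \<in> ob S"
        using T.T_ob [of K X] by simp
      have iso: "\<phi> K X Y \<in> isos V (shom S (T K X) Y) (ihom V K (shom S X Y))" if "Y \<in> ob S" for Y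
        using T.\<phi>_iso [of K X Y] that by simp
      note \<phi> [simp] = A.inv_arr_works(1-3) [OF iso]
      let ?\<alpha> = "elt_inv V K (shom S X (T K X)) (\<phi> K X (T K X) \<cdot>\<^bsub>V\<^esub> vunit (assoc_vcat S) (T K X))"
      \<comment> \<open>The composite of \<open>\<phi>\<close> with the unit is a morphism from the
        unit object to \<open>ihom V K (shom S X (T K X))\<close>, so its preimage under \<varpi>
        exists and has the type required in a cylinder.\<close>
      have \<alpha>: "?\<alpha> \<in> arr V" "src V ?\<alpha> = K" "tgt V ?\<alpha> = shom S X (T K X)"
        "elt V K (shom S X (T K X)) ?\<alpha> = \<phi> K X (T K X) \<cdot>\<^bsub>V\<^esub> vunit (assoc_vcat S) (T K X)"
        by (rule A.elt_inv_works; simp)+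
      show "T K X \<in> ob S"
        by simp
      show "?\<alpha> \<in> hom V K (shom S X (T K X))"
        using \<alpha> by (simp add: A.hom_iff)
      fix Y assume [simp]: "Y \<in> ob S"
      show "\<phi> K X Y \<in> isos V (shom S (T K X) Y) (ihom V K (shom S X Y))"
        by (rule iso) simp
      show "counit V K (shom S X Y) \<cdot>\<^bsub>V\<^esub> (\<phi> K X Y \<otimes>\<^sub>m\<^bsub>V\<^esub> idn V K)
          = scomp S X (T K X) Y \<cdot>\<^bsub>V\<^esub> (idn V (shom S (T K X) Y) \<otimes>\<^sub>m\<^bsub>V\<^esub> ?\<alpha>)"
        using A.vnatural_imp_cylinder [of K X "T K X" Y "\<phi> K X" ?\<alpha>] T.\<phi>_vnatural [of K X] \<alpha>
        by simp
    qed
  qed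
  ultimately show ?thesis
    by blast
qed

end
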